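(* Let $\mathbf{k}$ be a commutative ring, $q\in\mathbf{k}$ and $r:=q+1$. Let $n$ be a positive integer and let $\alpha\in\mathrm{Comp}_n$. Then, in $\mathrm{QSym}$, $$\eta_\alpha^{(q)}=r\sum_{\gamma\in\mathrm{Comp}_n}(-1)^{|D(\gamma)\setminus D(\alpha)|}\,q^{|D(\gamma)\cap D(\alpha)|}\,L_\gamma.$$
   Context: For an integer $m$, $[m]=\{1,2,\ldots,m\}$ (empty if $m\le 0$). A composition is a finite tuple $\alpha=(\alpha_1,\ldots,\alpha_k)$ of positive integers; its length is $\ell(\alpha)=k$, its size is $|\alpha|=\alpha_1+\cdots+\alpha_k$. $\mathrm{Comp}$ is the set of all compositions (including the empty one), and $\mathrm{Comp}_n$ the set of compositions of size $n$. For $\alpha=(\alpha_1,\ldots,\alpha_k)\in\mathrm{Comp}_n$ set $D(\alpha)=\{\alpha_1+\cdots+\alpha_i \mid i\in[k-1]\}\subseteq[n-1]$. $\mathrm{QSym}\subseteq\mathbf{k}[[x_1,x_2,\ldots]]$ is the algebra of quasisymmetric functions over $\mathbf{k}$, with $\mathbf{k}$-basis $(M_\alpha)_{\alpha\in\mathrm{Comp}}$ where $M_\alpha=\sum_{i_1<i_2<\cdots<i_\ell}x_{i_1}^{\alpha_1}\cdots x_{i_\ell}^{\alpha_\ell}$ for $\alpha=(\alpha_1,\ldots,\alpha_\ell)$. For $\alpha\in\mathrm{Comp}_n$, the fundamental quasisymmetric function is $L_\alpha=\sum_{\beta\in\mathrm{Comp}_n;\ D(\beta)\supseteq D(\alpha)}M_\beta$.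 For $\alpha\in\mathrm{Comp}_n$, $\eta_\alpha^{(q)}=\sum_{\beta\in\mathrm{Comp}_n;\ D(\beta)\subseteq D(\alpha)}r^{\ell(\beta)}M_\beta\in\mathrm{QSym}$. *)

theory Defs
  imports "HOL-Library.Poly_Mapping"
begin

typedef comp = "{xs :: nat list. \<forall>x\<in>set xs. 0 < x}"
  morphisms parts Abs_comp
  by (rule exI[of _ "[]"]) simp

definition comp_length :: "comp \<Rightarrow> nat" where
  "comp_length \<alpha> = length (parts \<alpha>)"

definition comp_size :: "comp \<Rightarrow> nat" where
  "comp_size \<alpha> = sum_list (parts \<alpha>)"

definition Comp :: "nat \<Rightarrow> comp set" where
  "Comp n = {\<alpha>. comp_size \<alpha> = n}"

definition D :: "comp \<Rightarrow> nat set" where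
  "D \<alpha> = {sum_list (take i (parts \<alpha>)) | i. i \<in> {1..comp_length \<alpha> - 1}}"

lemma finite_Comp: "finite (Comp n)"
proof -
  have "length xs \<le> sum_list xs" if "\<forall>x\<in>set xs. 0 < x" for xs :: "nat list"
    using that by (induction xs) auto
  moreover have "\<forall>x\<in>set (parts \<alpha>). 0 < x" for \<alpha>
    using parts[of \<alpha>] by simp
  ultimately have "parts ` Comp n \<subseteq> {xs. set xs \<subseteq> {..n} \<and> length xs \<le> n}"
    by (auto simp: Comp_def comp_size_def intro: member_le_sum_list)
  then have "finite (parts ` Comp n)"
    using finite_lists_length_le[of "{..n}" n] finite_subset by blast
  then show ?thesis
    by (rule finite_imageD) (simp add: inj_on_def parts_inject)
qed

text \<open>
  A monomial is its finitely supported exponent vector, and a formal power series is the family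
  of its coefficients.  The index \<open>i :: nat\<close> stands for the variable $x_{i+1}$.
  The list \<open>ks\<close> of indices and the list \<open>es\<close> of exponents have the same length in every use of
  \<open>monomial ks es\<close>, which is $\prod_j x_{k_j+1}^{e_j}$.
\<close>

type_synonym 'a power_series = "(nat \<Rightarrow>\<^sub>0 nat) \<Rightarrow> 'a"

definition monomial :: "nat list \<Rightarrow> nat list \<Rightarrow> (nat \<Rightarrow>\<^sub>0 nat)" where
  "monomial ks es = (\<Sum>j<length ks. Poly_Mapping.single (ks ! j) (es ! j))"

definition total_degree :: "(nat \<Rightarrow>\<^sub>0 nat) \<Rightarrow> nat" where
  "total_degree m = (\<Sum>i\<in>Poly_Mapping.keys m. Poly_Mapping.lookup m i)"

definition increasing_indices :: "nat \<Rightarrow> nat list set" where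
  "increasing_indices l = {ks. length ks = l \<and> sorted_wrt (<) ks}"

definition bounded_degree :: "'a::zero power_series \<Rightarrow> bool" where
  "bounded_degree f \<longleftrightarrow> (\<exists>d. \<forall>m. f m \<noteq> 0 \<longrightarrow> total_degree m \<le> d)"

definition quasisymmetric :: "'a power_series \<Rightarrow> bool" where
  "quasisymmetric f \<longleftrightarrow>
    (\<forall>\<alpha>. \<forall>ks \<in> increasing_indices (comp_length \<alpha>). \<forall>ls \<in> increasing_indices (comp_length \<alpha>).
      f (monomial ks (parts \<alpha>)) = f (monomial ls (parts \<alpha>)))"

typedef (overloaded) 'a qsym =
  "{f :: 'a::zero power_series. bounded_degree f \<and> quasisymmetric f}"
  morphisms qcoeff Abs_qsym
  by (rule exI[of _ "\<lambda>_. 0"]) (simp add: bounded_degree_def quasisymmetric_def)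

setup_lifting type_definition_qsym

lemma bounded_degree_combine:
  assumes "bounded_degree f" "bounded_degree g" "h 0 0 = 0"
  shows "bounded_degree (\<lambda>m. h (f m) (g m))"
proof -
  obtain d e where de: "\<And>m. f m \<noteq> 0 \<Longrightarrow> total_degree m \<le> d" "\<And>m. g m \<noteq> 0 \<Longrightarrow> total_degree m \<le> e"
    using assms(1,2) unfolding bounded_degree_def by blast
  have "total_degree m \<le> max d e" if "h (f m) (g m) \<noteq> 0" for m
    using that assms(3) de[of m] by (cases "f m = 0"; cases "g m = 0") auto
  then show ?thesis unfolding bounded_degree_def by blast
qed

lemma quasisymmetric_combine:
  assumes "quasisymmetric f" "quasisymmetric g"
  shows "quasisymmetric (\<lambda>m. h (f m) (g m))"
  unfolding quasisymmetric_def
proof (intro allI ballI)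
  fix \<alpha> ks ls
  assume "ks \<in> increasing_indices (comp_length \<alpha>)" "ls \<in> increasing_indices (comp_length \<alpha>)"
  then have "f (monomial ks (parts \<alpha>)) = f (monomial ls (parts \<alpha>))"
    "g (monomial ks (parts \<alpha>)) = g (monomial ls (parts \<alpha>))"
    using assms unfolding quasisymmetric_def by blast+
  then show "h (f (monomial ks (parts \<alpha>))) (g (monomial ks (parts \<alpha>))) =
      h (f (monomial ls (parts \<alpha>))) (g (monomial ls (parts \<alpha>)))"
    by simp
qed

instantiation qsym :: (comm_monoid_add) comm_monoid_add
begin

lift_definition zero_qsym :: "'a qsym" is "\<lambda>_. 0"
  by (simp add: bounded_degree_def quasisymmetric_def)

lift_definition plus_qsym :: "'a qsym \<Rightarrow> 'a qsym \<Rightarrow> 'a qsym" is "\<lambda>f g m. f m + g m"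
  by (elim conjE, intro conjI, rule bounded_degree_combine[where h = "(+)"],
      assumption, assumption, simp, rule quasisymmetric_combine[where h = "(+)"])

instance
  by standard
    (simp_all add: qcoeff_inject[symmetric] plus_qsym.rep_eq zero_qsym.rep_eq fun_eq_iff ac_simps)

end

instantiation qsym :: (ab_group_add) ab_group_add
begin

lift_definition uminus_qsym :: "'a qsym \<Rightarrow> 'a qsym" is "\<lambda>f m. - f m"
proof (elim conjE, intro conjI)
  fix f :: "'a power_series"
  assume f: "bounded_degree f" "quasisymmetric f"
  show "bounded_degree (\<lambda>m. - f m)"
    using bounded_degree_combine[OF f(1) f(1), of "\<lambda>a _. - a"] by simp
  show "quasisymmetric (\<lambda>m. - f m)"
    using quasisymmetric_combine[OF f(2) f(2), of "\<lambda>a _. - a"] .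
qed

lift_definition minus_qsym :: "'a qsym \<Rightarrow> 'a qsym \<Rightarrow> 'a qsym" is "\<lambda>f g m. f m - g m"
  by (elim conjE, intro conjI, rule bounded_degree_combine[where h = "(-)"],
      assumption, assumption, simp, rule quasisymmetric_combine[where h = "(-)"])

instance
  by standard
    (simp_all add: qcoeff_inject[symmetric] plus_qsym.rep_eq zero_qsym.rep_eq uminus_qsym.rep_eq
      minus_qsym.rep_eq fun_eq_iff)

end

text \<open>
  The sort \<open>{comm_ring, comm_monoid_mult}\<close> is that of commutative rings with unity; unlike
  \<^class>\<open>comm_ring_1\<close> it does not exclude the zero ring.
\<close>

lift_definition qscale :: "'a::{comm_ring, comm_monoid_mult} \<Rightarrow> 'a qsym \<Rightarrow> 'a qsym" (infixr "*\<^sub>Q" 75)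
  is "\<lambda>c f m. c * f m"
proof (elim conjE, intro conjI)
  fix c :: 'a and f :: "'a power_series"
  assume f: "bounded_degree f" "quasisymmetric f"
  show "bounded_degree (\<lambda>m. c * f m)"
    using bounded_degree_combine[OF f(1) f(1), of "\<lambda>a _. c * a"] by simp
  show "quasisymmetric (\<lambda>m. c * f m)"
    using quasisymmetric_combine[OF f(2) f(2), of "\<lambda>a _. c * a"] .
qed

lemma lookup_monomial:
  "Poly_Mapping.lookup (monomial ks es) k = (\<Sum>j<length ks. es ! j when ks ! j = k)"
  by (simp add: monomial_def lookup_sum lookup_single)

lemma lookup_monomial_nth:
  assumes "sorted_wrt (<) ks" "i < length ks"
  shows "Poly_Mapping.lookup (monomial ks es) (ks ! i) = es ! i"
proof -
  have "distinct ks" using assms(1) by (simp add: strict_sorted_iff)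
  then have "(\<Sum>j<length ks. es ! j when ks ! j = ks ! i) = (\<Sum>j<length ks. if j = i then es ! j else 0)"
    using assms(2) by (intro sum.cong) (auto simp: when_def nth_eq_iff_index_eq)
  then show ?thesis using assms(2) by (simp add: lookup_monomial)
qed

lemma keys_monomial:
  assumes "ks \<in> increasing_indices (comp_length \<alpha>)"
  shows "Poly_Mapping.keys (monomial ks (parts \<alpha>)) = set ks"
proof (intro set_eqI iffI)
  fix k assume "k \<in> set ks"
  then obtain i where i: "i < length ks" "k = ks ! i" by (auto simp: in_set_conv_nth)
  moreover have "0 < parts \<alpha> ! i"
    using parts[of \<alpha>] i assms by (simp add: increasing_indices_def comp_length_def)
  ultimately show "k \<in> Poly_Mapping.keys (monomial ks (parts \<alpha>))"
    using assms by (simp add: in_keys_iff lookup_monomial_nth increasing_indices_def)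
next
  fix k assume "k \<in> Poly_Mapping.keys (monomial ks (parts \<alpha>))"
  then have "(\<Sum>j<length ks. parts \<alpha> ! j when ks ! j = k) \<noteq> 0"
    by (simp add: in_keys_iff lookup_monomial)
  then show "k \<in> set ks"
    by (auto simp: when_def split: if_splits)
qed

lemma monomial_inject:
  assumes ks: "ks \<in> increasing_indices (comp_length \<alpha>)"
    and ls: "ls \<in> increasing_indices (comp_length \<beta>)"
    and eq: "monomial ks (parts \<alpha>) = monomial ls (parts \<beta>)"
  shows "ks = ls" "\<alpha> = \<beta>"
proof -
  have "set ks = set ls"
    using keys_monomial[OF ks] keys_monomial[OF ls] eq by simp
  then show "ks = ls"
    using ks ls by (auto simp: increasing_indices_def intro: strict_sorted_equal)
  with ks ls eq have "parts \<alpha> = parts \<beta>"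
    by (intro nth_equalityI)
       (auto simp: increasing_indices_def comp_length_def, metis lookup_monomial_nth)
  then show "\<alpha> = \<beta>" by (simp add: parts_inject)
qed

lemma total_degree_monomial:
  assumes "ks \<in> increasing_indices (comp_length \<alpha>)"
  shows "total_degree (monomial ks (parts \<alpha>)) = comp_size \<alpha>"
proof -
  have sorted: "sorted_wrt (<) ks" and len: "length ks = length (parts \<alpha>)"
    using assms by (simp_all add: increasing_indices_def comp_length_def)
  then have dist: "distinct ks" by (simp add: strict_sorted_iff)
  have "total_degree (monomial ks (parts \<alpha>))
      = (\<Sum>k\<in>set ks. Poly_Mapping.lookup (monomial ks (parts \<alpha>)) k)"
    by (simp add: total_degree_def keys_monomial[OF assms])
  also have "\<dots> = (\<Sum>j<length ks. Poly_Mapping.lookup (monomial ks (parts \<alpha>)) (ks ! j))"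
    using sum.reindex_bij_betw[OF bij_betw_nth[OF dist refl refl],
        of "Poly_Mapping.lookup (monomial ks (parts \<alpha>))"] by simp
  also have "\<dots> = (\<Sum>j<length ks. parts \<alpha> ! j)"
    using sorted by (simp add: lookup_monomial_nth)
  also have "\<dots> = comp_size \<alpha>"
    by (simp add: comp_size_def sum_list_sum_nth len atLeast0LessThan)
  finally show ?thesis .
qed

text \<open>
  The coefficient of a monomial \<open>m\<close> in the infinite sum defining $M_\alpha$ collects a summand \<open>1\<close>
  for each index tuple whose monomial is \<open>m\<close>; by \<open>monomial_inject\<close> there is at most one.
\<close>

lift_definition M :: "comp \<Rightarrow> 'a::{comm_ring, comm_monoid_mult} qsym" is
  "\<lambda>\<alpha> m. \<Sum>ks | ks \<in> increasing_indices (comp_length \<alpha>) \<and> monomial ks (parts \<alpha>) = m. 1"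
proof (intro conjI)
  fix \<alpha>
  let ?f = "\<lambda>m. \<Sum>ks | ks \<in> increasing_indices (comp_length \<alpha>) \<and> monomial ks (parts \<alpha>) = m. 1 :: 'a"
  have "total_degree m \<le> comp_size \<alpha>" if "?f m \<noteq> 0" for m
  proof -
    have "{ks. ks \<in> increasing_indices (comp_length \<alpha>) \<and> monomial ks (parts \<alpha>) = m} \<noteq> {}"
      using that by (metis sum.empty)
    then show ?thesis using total_degree_monomial by fastforce
  qed
  then show "bounded_degree ?f" unfolding bounded_degree_def by blast
  have "?f (monomial ks (parts \<beta>)) = (if \<alpha> = \<beta> then 1 else 0)"
    if "ks \<in> increasing_indices (comp_length \<beta>)" for ks \<beta>
  proof -
    have "{ls. ls \<in> increasing_indices (comp_length \<alpha>) \<and> monomial ls (parts \<alpha>) = monomial ks (parts \<beta>)}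
        = (if \<alpha> = \<beta> then {ks} else {})"
      using that monomial_inject by auto
    then show ?thesis by simp
  qed
  then show "quasisymmetric ?f" unfolding quasisymmetric_def by simp
qed

definition L :: "comp \<Rightarrow> 'a::{comm_ring, comm_monoid_mult} qsym" where
  "L \<alpha> = (\<Sum>\<beta> | \<beta> \<in> Comp (comp_size \<alpha>) \<and> D \<beta> \<supseteq> D \<alpha>. M \<beta>)"

definition eta :: "'a::{comm_ring, comm_monoid_mult} \<Rightarrow> comp \<Rightarrow> 'a qsym" where
  "eta q \<alpha> = (\<Sum>\<beta> | \<beta> \<in> Comp (comp_size \<alpha>) \<and> D \<beta> \<subseteq> D \<alpha>. (q + 1) ^ comp_length \<beta> *\<^sub>Q M \<beta>)"

end

theory Submission
  imports Defs
begin

text \<open>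
  Both sides are combinations of the monomial functions \<open>M \<beta>\<close> with \<open>\<beta> \<in> Comp n\<close>, so it is
  enough to compare coefficients.  After expanding each \<open>L \<gamma>\<close>, the coefficient of \<open>M \<beta>\<close> on the
  right is \<open>r\<close> times the sum of \<open>(- 1) ^ card (D \<gamma> - D \<alpha>) * q ^ card (D \<gamma> \<inter> D \<alpha>)\<close> over
  all \<open>\<gamma>\<close> with \<open>D \<gamma> \<subseteq> D \<beta>\<close>.  A composition of \<open>n > 0\<close> is determined by its partial sums, which
  form an arbitrary subset of \<open>{1..<n}\<close> (\<open>bij_betw_D\<close>); hence \<open>D \<gamma>\<close> runs through all
  subsets of \<open>D \<beta>\<close>, each once.  The summand is a product of local weights, \<open>q\<close> for an
  element of \<open>D \<alpha>\<close> and \<open>- 1\<close> for any other element, so the sum factors as the product over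
  \<open>d \<in> D \<beta>\<close> of \<open>1\<close> plus the weight of \<open>d\<close>.  The factor is \<open>q + 1 = r\<close> inside \<open>D \<alpha>\<close> and \<open>0\<close>
  outside (\<open>sum_Pow_weight\<close>).  Thus only the \<open>\<beta>\<close> with \<open>D \<beta> \<subseteq> D \<alpha>\<close> survive, with
  coefficient \<open>r * r ^ card (D \<beta>) = r ^ comp_length \<beta>\<close>, which is the definition of \<open>eta\<close>.
\<close>

section \<open>Compositions and their partial sums\<close>

text \<open>
  The full sum \<open>sum_list xs\<close> is included here and excluded in \<open>D\<close>; with it, appending
  an entry simply adds one new maximum, which makes inductions from the end work.
\<close>

definition partial_sums :: "nat list \<Rightarrow> nat set" where
  "partial_sums xs = (\<lambda>i. sum_list (take i xs)) ` {1..length xs}"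

lemma partial_sums_Nil [simp]: "partial_sums [] = {}"
  by (simp add: partial_sums_def)

lemma partial_sums_snoc [simp]:
  "partial_sums (xs @ [x]) = insert (sum_list xs + x) (partial_sums xs)"
proof -
  have "{1..length (xs @ [x])} = insert (Suc (length xs)) {1..length xs}" by auto
  then show ?thesis by (simp add: partial_sums_def)
qed

lemma partial_sums_bounds:
  assumes "\<forall>x\<in>set xs. 0 < x"
  shows "partial_sums xs \<subseteq> {0<..sum_list xs}"
  using assms by (induction xs rule: rev_induct) force+

lemma finite_partial_sums [simp]: "finite (partial_sums xs)"
  by (simp add: partial_sums_def)

lemma sum_list_notin_partial_sums:
  assumes "\<forall>x\<in>set xs. 0 < x" "0 < x"
  shows "sum_list xs + x \<notin> partial_sums xs"
  using partial_sums_bounds[OF assms(1)] assms(2) by fastforce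

lemma card_partial_sums:
  assumes "\<forall>x\<in>set xs. 0 < x"
  shows "card (partial_sums xs) = length xs"
  using assms
  by (induction xs rule: rev_induct) (simp_all add: sum_list_notin_partial_sums)

lemma partial_sums_inject:
  assumes "\<forall>x\<in>set xs. 0 < x" "\<forall>y\<in>set ys. 0 < y" "partial_sums xs = partial_sums ys"
  shows "xs = ys"
  using assms
proof (induction xs arbitrary: ys rule: rev_induct)
  case Nil
  then show ?case by (cases ys rule: rev_cases) auto
next
  case (snoc x xs)
  then obtain y zs where ys: "ys = zs @ [y]"
    by (cases ys rule: rev_cases) auto
  have pos: "\<forall>x\<in>set xs. 0 < x" "\<forall>z\<in>set zs. 0 < z" "0 < x" "0 < y"
    using snoc.prems ys by auto
  have eq: "insert (sum_list xs + x) (partial_sums xs) = insert (sum_list zs + y) (partial_sums zs)"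
    using snoc.prems ys by simp
  \<comment> \<open>The largest partial sum is the full sum, so the two lists have the same sum.\<close>
  have bounds: "\<And>s. s \<in> partial_sums xs \<Longrightarrow> s \<le> sum_list xs"
      "\<And>s. s \<in> partial_sums zs \<Longrightarrow> s \<le> sum_list zs"
    using partial_sums_bounds[OF pos(1)] partial_sums_bounds[OF pos(2)] by auto
  have "sum_list xs + x \<in> insert (sum_list zs + y) (partial_sums zs)"
    "sum_list zs + y \<in> insert (sum_list xs + x) (partial_sums xs)"
    using eq by blast+
  then have top: "sum_list xs + x = sum_list zs + y"
    using bounds(1)[of "sum_list zs + y"] bounds(2)[of "sum_list xs + x"] by auto
  then have "partial_sums xs = partial_sums zs"
    using eq pos sum_list_notin_partial_sums by (metis insert_ident)
  then have "xs = zs" using snoc.IH pos by blast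
  with top ys show ?case by simp
qed

text \<open>
  The list is built from the smallest element of the set upwards.  To append the next element,
  the sum so far has to be smaller than it; this holds because that sum is \<open>0\<close> or a smaller
  element of the set, which is what the last conjunct records.
\<close>

lemma ex_partial_sums:
  assumes "finite S" "0 \<notin> S"
  shows "\<exists>xs. (\<forall>x\<in>set xs. 0 < x) \<and> partial_sums xs = S \<and> sum_list xs \<in> insert 0 S"
  using assms
proof (induction S rule: finite_linorder_max_induct)
  case empty
  show ?case by (rule exI[of _ "[]"]) simp
next
  case (insert m S)
  then obtain xs where xs: "\<forall>x\<in>set xs. 0 < x" "partial_sums xs = S" "sum_list xs \<in> insert 0 S"
    by auto
  have "0 < m" using insert.prems by (cases m) auto
  with xs(3) insert.hyps(2) have "sum_list xs < m" by (metis insert_iff)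
  then show ?case
    using xs by (intro exI[of _ "xs @ [m - sum_list xs]"]) auto
qed

lemma parts_pos: "\<forall>x\<in>set (parts \<alpha>). 0 < x"
  using parts[of \<alpha>] by simp

lemma parts_snoc:
  assumes "\<alpha> \<in> Comp n" "0 < n"
  obtains xs x where "parts \<alpha> = xs @ [x]" "sum_list xs + x = n" "\<forall>y\<in>set xs. 0 < y" "0 < x"
  using assms parts_pos[of \<alpha>]
  by (cases "parts \<alpha>" rule: rev_cases) (auto simp: Comp_def comp_size_def)

lemma D_snoc:
  assumes "parts \<alpha> = xs @ [x]"
  shows "D \<alpha> = partial_sums xs"
proof -
  have "D \<alpha> = (\<lambda>i. sum_list (take i (xs @ [x]))) ` {1..length xs}"
    using assms by (auto simp: D_def comp_length_def simp del: take_append)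
  also have "\<dots> = partial_sums xs"
    unfolding partial_sums_def by (rule image_cong) simp_all
  finally show ?thesis .
qed

lemma comp_length_eq_Suc_card_D:
  assumes "\<alpha> \<in> Comp n" "0 < n"
  shows "comp_length \<alpha> = Suc (card (D \<alpha>))"
  using assms by (rule parts_snoc) (simp add: D_snoc card_partial_sums comp_length_def)

lemma inj_on_D:
  assumes "0 < n"
  shows "inj_on D (Comp n)"
proof (rule inj_onI)
  fix \<alpha> \<beta> assume \<alpha>: "\<alpha> \<in> Comp n" and \<beta>: "\<beta> \<in> Comp n" and eq: "D \<alpha> = D \<beta>"
  obtain xs x where xs: "parts \<alpha> = xs @ [x]" "sum_list xs + x = n" "\<forall>y\<in>set xs. 0 < y"
    using \<alpha> assms by (rule parts_snoc)
  obtain ys y where ys: "parts \<beta> = ys @ [y]" "sum_list ys + y = n" "\<forall>z\<in>set ys. 0 < z"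
    using \<beta> assms by (rule parts_snoc)
  have "xs = ys"
    using eq xs ys by (intro partial_sums_inject) (simp_all add: D_snoc)
  with xs ys have "parts \<alpha> = parts \<beta>" by auto
  then show "\<alpha> = \<beta>" by (simp add: parts_inject)
qed

lemma image_D_Comp:
  assumes "0 < n"
  shows "D ` Comp n = Pow {1..<n}"
proof (intro equalityI subsetI)
  fix S assume "S \<in> D ` Comp n"
  then obtain \<alpha> where \<alpha>: "\<alpha> \<in> Comp n" "S = D \<alpha>" by blast
  obtain xs x where "parts \<alpha> = xs @ [x]" "sum_list xs + x = n" "\<forall>y\<in>set xs. 0 < y" "0 < x"
    using \<alpha>(1) assms by (rule parts_snoc)
  then show "S \<in> Pow {1..<n}"
    using partial_sums_bounds[of xs] \<alpha>(2) by (fastforce simp: D_snoc)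
next
  fix S assume S: "S \<in> Pow {1..<n}"
  then have "finite S" "0 \<notin> S" by (auto intro: finite_subset)
  then obtain xs where xs: "\<forall>x\<in>set xs. 0 < x" "partial_sums xs = S" "sum_list xs \<in> insert 0 S"
    using ex_partial_sums by blast
  have less: "sum_list xs < n"
    using xs(3) S assms by (metis PowD atLeastLessThan_iff insert_iff subsetD)
  define \<alpha> where "\<alpha> = Abs_comp (xs @ [n - sum_list xs])"
  have parts: "parts \<alpha> = xs @ [n - sum_list xs]"
    using xs(1) less by (auto simp: \<alpha>_def Abs_comp_inverse)
  then have "\<alpha> \<in> Comp n" using less by (simp add: Comp_def comp_size_def)
  moreover have "D \<alpha> = S" using parts xs(2) by (simp add: D_snoc)
  ultimately show "S \<in> D ` Comp n" by blast
qed

lemma bij_betw_D: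
  assumes "0 < n"
  shows "bij_betw D (Comp n) (Pow {1..<n})"
  using inj_on_D[OF assms] image_D_Comp[OF assms] by (simp add: bij_betw_def)

lemma finite_D:
  assumes "\<beta> \<in> Comp n" "0 < n"
  shows "finite (D \<beta>)"
  using assms bij_betw_D[of n] by (auto simp: bij_betw_def intro: finite_subset)

text \<open>
  The coarsenings \<open>\<gamma>\<close> of a composition \<open>\<beta>\<close> correspond to the subsets of \<open>D \<beta>\<close>.
\<close>

lemma sum_coarsenings_eq_sum_Pow:
  assumes "\<beta> \<in> Comp n" "0 < n"
  shows "(\<Sum>\<gamma> | \<gamma> \<in> Comp n \<and> D \<gamma> \<subseteq> D \<beta>. f (D \<gamma>)) = (\<Sum>S\<in>Pow (D \<beta>). f S)"
proof (rule sum.reindex_bij_betw)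
  have "D \<beta> \<subseteq> {1..<n}"
    using assms image_D_Comp by blast
  then have "D ` Comp n \<inter> Pow (D \<beta>) = Pow (D \<beta>)"
    using image_D_Comp[OF assms(2)] by auto
  moreover have "D ` {\<gamma> \<in> Comp n. D \<gamma> \<subseteq> D \<beta>} = D ` Comp n \<inter> Pow (D \<beta>)"
    by auto
  ultimately have "D ` {\<gamma> \<in> Comp n. D \<gamma> \<subseteq> D \<beta>} = Pow (D \<beta>)"
    by (rule trans[rotated])
  then show "bij_betw D {\<gamma> \<in> Comp n. D \<gamma> \<subseteq> D \<beta>} (Pow (D \<beta>))"
    using inj_on_D[OF assms(2)] by (auto simp: bij_betw_def inj_on_def)
qed

section \<open>The weighted sum over subsets\<close>

text \<open>
  Splitting the subsets of \<open>insert b B\<close> according to whether they contain \<open>b\<close> multiplies the sum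
  by \<open>1 + q\<close> if \<open>b \<in> A\<close>, and by \<open>1 - 1 = 0\<close> otherwise.
\<close>

lemma sum_Pow_weight:
  fixes q :: "'a::{comm_ring, comm_monoid_mult}"
  assumes "finite B"
  shows "(\<Sum>S\<in>Pow B. (- 1) ^ card (S - A) * q ^ card (S \<inter> A)) =
    (if B \<subseteq> A then (q + 1) ^ card B else 0)"
  using assms
proof (induction B rule: finite_induct)
  case empty
  show ?case by simp
next
  case (insert b B)
  define w where "w S = (- 1) ^ card (S - A) * q ^ card (S \<inter> A)" for S
  define c where "c = (if b \<in> A then q else - 1)"
  have w_insert: "w (insert b S) = c * w S" if "S \<in> Pow B" for S
  proof -
    have "finite S" "b \<notin> S" using that insert by (auto intro: finite_subset)
    then show ?thesis
      by (simp add: w_def c_def insert_Diff_if mult_ac)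
  qed
  have "inj_on (insert b) (Pow B)"
    using insert.hyps by (auto simp: inj_on_def)
  then have "(\<Sum>S\<in>insert b ` Pow B. w S) = (\<Sum>S\<in>Pow B. w (insert b S))"
    by (simp add: sum.reindex)
  also have "\<dots> = c * (\<Sum>S\<in>Pow B. w S)"
    by (simp add: w_insert sum_distrib_left)
  finally have image: "(\<Sum>S\<in>insert b ` Pow B. w S) = c * (\<Sum>S\<in>Pow B. w S)" .
  have "(\<Sum>S\<in>Pow (insert b B). w S) = (\<Sum>S\<in>Pow B. w S) + (\<Sum>S\<in>insert b ` Pow B. w S)"
    unfolding Pow_insert using insert.hyps by (intro sum.union_disjoint) auto
  also have "\<dots> = (c + 1) * (\<Sum>S\<in>Pow B. w S)"
    by (simp add: image distrib_right add.commute)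
  also have "\<dots> = (if insert b B \<subseteq> A then (q + 1) ^ card (insert b B) else 0)"
    using insert unfolding w_def by (simp add: c_def)
  finally show ?case unfolding w_def .
qed

section \<open>Scalar multiplication of quasisymmetric functions\<close>

lemma qscale_simps:
  fixes x y :: "'a::{comm_ring, comm_monoid_mult} qsym"
  shows "c *\<^sub>Q (x + y) = c *\<^sub>Q x + c *\<^sub>Q y"
    and "(c + d) *\<^sub>Q x = c *\<^sub>Q x + d *\<^sub>Q x"
    and "c *\<^sub>Q d *\<^sub>Q x = (c * d) *\<^sub>Q x"
    and "c *\<^sub>Q (0 :: 'a qsym) = 0"
    and "0 *\<^sub>Q x = 0"
  by (transfer; simp add: algebra_simps)+

lemma qscale_sum_right: "c *\<^sub>Q (\<Sum>i\<in>I. f i) = (\<Sum>i\<in>I. c *\<^sub>Q f i)"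
  by (induction I rule: infinite_finite_induct) (simp_all add: qscale_simps)

lemma qscale_sum_left: "(\<Sum>i\<in>I. c i) *\<^sub>Q x = (\<Sum>i\<in>I. c i *\<^sub>Q x)"
  by (induction I rule: infinite_finite_induct) (simp_all add: qscale_simps)

section \<open>The expansion in the fundamental basis\<close>

text \<open>
  Interchanging the two summations gives the coefficients of a combination of fundamental
  functions in the monomial basis.
\<close>

lemma sum_qscale_L:
  "(\<Sum>\<gamma>\<in>Comp n. c \<gamma> *\<^sub>Q L \<gamma>) =
    (\<Sum>\<beta>\<in>Comp n. (\<Sum>\<gamma> | \<gamma> \<in> Comp n \<and> D \<gamma> \<subseteq> D \<beta>. c \<gamma>) *\<^sub>Q M \<beta>)"
proof -
  have "(\<Sum>\<gamma>\<in>Comp n. c \<gamma> *\<^sub>Q L \<gamma>) =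
      (\<Sum>\<gamma>\<in>Comp n. \<Sum>\<beta> | \<beta> \<in> Comp n \<and> D \<gamma> \<subseteq> D \<beta>. c \<gamma> *\<^sub>Q M \<beta>)"
    by (intro sum.cong refl) (simp add: L_def qscale_sum_right Comp_def)
  also have "\<dots> = (\<Sum>\<beta>\<in>Comp n. \<Sum>\<gamma> | \<gamma> \<in> Comp n \<and> D \<gamma> \<subseteq> D \<beta>. c \<gamma> *\<^sub>Q M \<beta>)"
    by (rule sum.swap_restrict) (simp_all add: finite_Comp)
  finally show ?thesis by (simp add: qscale_sum_left)
qed

theorem proposition3p11:
  fixes q r :: "'a::{comm_ring, comm_monoid_mult}" and n :: nat and \<alpha> :: comp
  assumes "r = q + 1" and "0 < n" and "\<alpha> \<in> Comp n"
  shows "eta q \<alpha> =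
    r *\<^sub>Q (\<Sum>\<gamma>\<in>Comp n. ((- 1) ^ card (D \<gamma> - D \<alpha>) * q ^ card (D \<gamma> \<inter> D \<alpha>)) *\<^sub>Q L \<gamma>)"
proof -
  let ?w = "\<lambda>S. (- 1) ^ card (S - D \<alpha>) * q ^ card (S \<inter> D \<alpha>)"
  have coeff: "r *\<^sub>Q (\<Sum>\<gamma> | \<gamma> \<in> Comp n \<and> D \<gamma> \<subseteq> D \<beta>. ?w (D \<gamma>)) *\<^sub>Q M \<beta> =
      (if D \<beta> \<subseteq> D \<alpha> then r ^ comp_length \<beta> *\<^sub>Q M \<beta> else 0)" if \<beta>: "\<beta> \<in> Comp n" for \<beta>
  proof -
    have "(\<Sum>\<gamma> | \<gamma> \<in> Comp n \<and> D \<gamma> \<subseteq> D \<beta>. ?w (D \<gamma>)) = (\<Sum>S\<in>Pow (D \<beta>). ?w S)"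
      using \<beta> assms(2) by (rule sum_coarsenings_eq_sum_Pow)
    also have "\<dots> = (if D \<beta> \<subseteq> D \<alpha> then r ^ card (D \<beta>) else 0)"
      using \<beta> assms by (simp add: sum_Pow_weight finite_D)
    finally show ?thesis
      using \<beta> assms(2) by (simp add: qscale_simps comp_length_eq_Suc_card_D)
  qed
  have "r *\<^sub>Q (\<Sum>\<gamma>\<in>Comp n. ?w (D \<gamma>) *\<^sub>Q L \<gamma>) =
      (\<Sum>\<beta>\<in>Comp n. if D \<beta> \<subseteq> D \<alpha> then r ^ comp_length \<beta> *\<^sub>Q M \<beta> else 0)"
    by (simp add: sum_qscale_L qscale_sum_right coeff)
  also have "\<dots> = (\<Sum>\<beta> | \<beta> \<in> Comp n \<and> D \<beta> \<subseteq> D \<alpha>. r ^ comp_length \<beta> *\<^sub>Q M \<beta>)"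
    by (simp add: sum.inter_filter finite_Comp)
  also have "\<dots> = eta q \<alpha>"
    using assms by (simp add: eta_def Comp_def)
  finally show ?thesis by simp
qed

end
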